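(* Let $G$ and $H$ be finite simple graphs with $G\in\mathfrak{F}$. Then $\gamma_R(G\Box H)\ge \gamma(G)\gamma_R(H)$.
   Context: $\gamma(X)$ denotes the domination number of a graph $X$ (minimum size of a set $D$ such that every vertex outside $D$ has a neighbor in $D$). A Roman dominating function on $X$ is a map $f:V(X)\to\{0,1,2\}$ such that every vertex $v$ with $f(v)=0$ has a neighbor $u$ with $f(u)=2$; $\gamma_R(X)$ is the minimum of $\sum_v f(v)$ over such $f$. $\mathfrak{F}$ is the class of graphs $G$ having a dominating set $S=\{u_1,\dots,u_{\gamma(G)}\}$ of size $\gamma(G)$ with $N[u_i]\cap N[u_j]=\emptyset$ for all $i\ne j$ (an efficient dominating set), where $N[u]$ is the closed neighborhood of $u$. The Cartesian product $G\Box H$ has vertex set $V(G)\times V(H)$, with $(g,h)\sim(g',h')$ iff ($g=g'$ and $h\sim h'$) or ($g\sim g'$ and $h=h'$). *)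

theory Defs
  imports "Graph_Theory.Pair_Digraph"
begin

text \<open>
  A finite simple graph is a \<^locale>\<open>pair_graph\<close>: a finite vertex set with a symmetric,
  irreflexive set of vertex pairs. An undirected edge is thus represented by its two
  orientations, and (u, v) being an arc means that u and v are adjacent.
\<close>

definition closed_nbhd :: "'a pair_pre_digraph \<Rightarrow> 'a \<Rightarrow> 'a set" where
  "closed_nbhd G u = insert u {v \<in> pverts G. (u, v) \<in> parcs G}"

definition dominating_set :: "'a pair_pre_digraph \<Rightarrow> 'a set \<Rightarrow> bool" where
  "dominating_set G D \<longleftrightarrow>
     D \<subseteq> pverts G \<and> (\<forall>v \<in> pverts G - D. \<exists>u \<in> D. (v, u) \<in> parcs G)"

definition domination_number :: "'a pair_pre_digraph \<Rightarrow> nat" where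
  "domination_number G = (LEAST k. \<exists>D. dominating_set G D \<and> card D = k)"

text \<open>Only the values of f on the vertex set are relevant here.\<close>

definition roman_dominating :: "'a pair_pre_digraph \<Rightarrow> ('a \<Rightarrow> nat) \<Rightarrow> bool" where
  "roman_dominating G f \<longleftrightarrow>
     (\<forall>v \<in> pverts G. f v \<in> {0, 1, 2}) \<and>
     (\<forall>v \<in> pverts G. f v = 0 \<longrightarrow> (\<exists>u \<in> pverts G. (v, u) \<in> parcs G \<and> f u = 2))"

definition roman_domination_number :: "'a pair_pre_digraph \<Rightarrow> nat" where
  "roman_domination_number G =
     (LEAST k. \<exists>f. roman_dominating G f \<and> (\<Sum>v \<in> pverts G. f v) = k)"

definition efficiently_dominated :: "'a pair_pre_digraph \<Rightarrow> bool" where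
  "efficiently_dominated G \<longleftrightarrow>
     (\<exists>S. dominating_set G S \<and> card S = domination_number G \<and>
          (\<forall>u \<in> S. \<forall>v \<in> S. u \<noteq> v \<longrightarrow> closed_nbhd G u \<inter> closed_nbhd G v = {}))"

definition cart_prod ::
  "'a pair_pre_digraph \<Rightarrow> 'b pair_pre_digraph \<Rightarrow> ('a \<times> 'b) pair_pre_digraph" where
  "cart_prod G H =
     \<lparr> pverts = pverts G \<times> pverts H,
       parcs = {((g, h), (g', h')).
          (g \<in> pverts G \<and> g = g' \<and> (h, h') \<in> parcs H) \<or>
          ((g, g') \<in> parcs G \<and> h \<in> pverts H \<and> h = h')} \<rparr>"

text \<open>The minima above are attained, and the product is again a finite simple graph.\<close>

lemma domination_number_attained:
  "\<exists>D. dominating_set G D \<and> card D = domination_number G"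
  unfolding domination_number_def
  by (rule LeastI_ex) (auto simp: dominating_set_def)

lemma roman_domination_number_attained:
  "\<exists>f. roman_dominating G f \<and> (\<Sum>v \<in> pverts G. f v) = roman_domination_number G"
  unfolding roman_domination_number_def
proof (rule LeastI_ex)
  have "roman_dominating G (\<lambda>_. 1)"
    by (simp add: roman_dominating_def)
  then show "\<exists>k f. roman_dominating G f \<and> (\<Sum>v \<in> pverts G. f v) = k"
    by blast
qed

lemma pair_graph_cart_prod:
  assumes "pair_graph G" and "pair_graph H"
  shows "pair_graph (cart_prod G H)"
proof -
  interpret G: pair_graph G by fact
  interpret H: pair_graph H by fact
  have sub: "parcs (cart_prod G H) \<subseteq>
      (pverts G \<times> pverts H) \<times> (pverts G \<times> pverts H)"
    by (auto simp: cart_prod_def dest: G.wellformed' H.wellformed')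
  have fin: "finite (pverts G \<times> pverts H)"
    by (simp add: G.pair_finite_verts H.pair_finite_verts)
  have symG: "sym (parcs G)" and symH: "sym (parcs H)"
    using G.pair_sym_arcs H.pair_sym_arcs by (simp_all add: symmetric_def)
  have "sym (parcs (cart_prod G H))"
    by (rule symI) (auto simp: cart_prod_def dest: symD[OF symG] symD[OF symH])
  moreover have "fst e \<noteq> snd e" if "e \<in> parcs (cart_prod G H)" for e
    using that G.pair_no_loops H.pair_no_loops by (fastforce simp: cart_prod_def)
  moreover have "finite (parcs (cart_prod G H))"
    using sub fin by (meson finite_SigmaI finite_subset)
  moreover have "pverts (cart_prod G H) = pverts G \<times> pverts H"
    by (simp add: cart_prod_def)
  ultimately show ?thesis
    using sub fin by unfold_locales (auto simp: symmetric_def)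
qed

end

theory Submission
  imports Defs
begin

text \<open>
  Let S be an efficient dominating set of G and f a Roman dominating function of minimum weight on
  the product. For each u in S, the function sending h to the maximum of f over
  N[u] \<times> {h} is Roman dominating on H, because all neighbours of (u, h) outside the fibre over u
  lie in N[u] \<times> {h}. Its weight is at most that of f on N[u] \<times> V(H), and these blocks are
  pairwise disjoint.
\<close>

lemma roman_domination_number_le:
  "roman_dominating G f \<Longrightarrow> roman_domination_number G \<le> (\<Sum>v \<in> pverts G. f v)"
  unfolding roman_domination_number_def by (rule Least_le) blast

lemma (in pair_fin_digraph) closed_nbhd_subset: "u \<in> pverts G \<Longrightarrow> closed_nbhd G u \<subseteq> pverts G"
  by (auto simp: closed_nbhd_def)

lemma (in pair_fin_digraph) finite_closed_nbhd: "finite (closed_nbhd G u)"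
  by (simp add: closed_nbhd_def)

lemma roman_dominating_Max_closed_nbhd:
  assumes "pair_graph G" and u: "u \<in> pverts G"
    and f: "roman_dominating (cart_prod G H) f"
  shows "roman_dominating H (\<lambda>h. Max ((\<lambda>x. f (x, h)) ` closed_nbhd G u))"
proof -
  interpret G: pair_graph G by fact
  define N where "N = closed_nbhd G u"
  define m where "m h = Max ((\<lambda>x. f (x, h)) ` N)" for h
  have fin: "finite N" and sub: "N \<subseteq> pverts G" and uN: "u \<in> N"
    using G.finite_closed_nbhd G.closed_nbhd_subset[OF u] by (auto simp: N_def closed_nbhd_def)
  have m_ge: "f (x, h) \<le> m h" if "x \<in> N" for x h
    using fin that by (simp add: m_def)
  \<comment> \<open>The maximum is attained, as \<open>N\<close> is finite and contains
    \<open>u\<close>. Hence \<open>m\<close> only takes values of \<open>f\<close>, which on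
    vertices are 0, 1 or 2.\<close>
  have m_in: "m h \<in> (\<lambda>x. f (x, h)) ` N" for h
    unfolding m_def using fin uN by (intro Max_in) auto
  have m_val: "m h \<in> {0, 1, 2}" if "h \<in> pverts H" for h
  proof -
    obtain x where "x \<in> N" "m h = f (x, h)"
      using m_in by blast
    moreover have "(x, h) \<in> pverts (cart_prod G H)"
      using \<open>x \<in> N\<close> sub that by (auto simp: cart_prod_def)
    ultimately show ?thesis
      using f unfolding roman_dominating_def by metis
  qed
  have "\<exists>h' \<in> pverts H. (h, h') \<in> parcs H \<and> m h' = 2" if h: "h \<in> pverts H" and "m h = 0" for h
  proof -
    have zero: "f (x, h) = 0" if "x \<in> N" for x
      using m_ge[OF that, of h] \<open>m h = 0\<close> by simp
    have "(u, h) \<in> pverts (cart_prod G H)"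
      using u h by (simp add: cart_prod_def)
    then obtain x h' where xh: "(x, h') \<in> pverts (cart_prod G H)" "f (x, h') = 2"
      and arc: "((u, h), (x, h')) \<in> parcs (cart_prod G H)"
      using f zero[OF uN] unfolding roman_dominating_def by (metis surj_pair)
    \<comment> \<open>An arc along \<open>G\<close> would put (\<open>x\<close>, \<open>h'\<close>)
      into \<open>N\<close> \<times> {\<open>h\<close>}, where \<open>f\<close> vanishes because
      \<open>m h = 0\<close>. So the neighbour of value 2 lies in the fibre over
      \<open>u\<close>.\<close>
    have "\<not> ((u, x) \<in> parcs G \<and> h = h')"
      using zero[of x] xh by (auto simp: N_def closed_nbhd_def cart_prod_def)
    then have "x = u" and adj: "(h, h') \<in> parcs H"
      using arc by (auto simp: cart_prod_def)
    have h': "h' \<in> pverts H"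
      using xh by (simp add: cart_prod_def)
    \<comment> \<open>As \<open>u\<close> itself lies in \<open>N\<close>, the value 2 at
      (\<open>u\<close>, \<open>h'\<close>) counts towards the maximum; \<open>m_val\<close> caps it
      at 2.\<close>
    have "2 \<le> m h'"
      using m_ge[OF uN, of h'] xh \<open>x = u\<close> by simp
    then show ?thesis
      using m_val[OF h'] h' adj by auto
  qed
  then have "roman_dominating H m"
    using m_val by (auto simp: roman_dominating_def)
  then show ?thesis
    by (simp add: m_def[abs_def] N_def)
qed

text \<open>The contribution of a single vertex \<open>u\<close>: the weight of the Roman dominating
  function of row maxima bounds the Roman domination number of \<open>H\<close> from above.\<close>

lemma roman_domination_number_le_block:
  assumes "pair_graph G" and u: "u \<in> pverts G"
    and f: "roman_dominating (cart_prod G H) f"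
  shows "roman_domination_number H \<le> (\<Sum>p \<in> closed_nbhd G u \<times> pverts H. f p)"
proof -
  interpret G: pair_graph G by fact
  let ?N = "closed_nbhd G u"
  have fin: "finite ?N" and "?N \<noteq> {}"
    by (rule G.finite_closed_nbhd) (simp add: closed_nbhd_def)
  have "roman_domination_number H \<le> (\<Sum>h \<in> pverts H. Max ((\<lambda>x. f (x, h)) ` ?N))"
    by (intro roman_domination_number_le roman_dominating_Max_closed_nbhd assms)
  \<comment> \<open>The values are natural numbers, so each one, and thus their maximum, is at most
    their sum.\<close>
  also have "\<dots> \<le> (\<Sum>h \<in> pverts H. \<Sum>x \<in> ?N. f (x, h))"
    using fin \<open>?N \<noteq> {}\<close> by (intro sum_mono) (auto intro: member_le_sum)
  also have "\<dots> = (\<Sum>p \<in> ?N \<times> pverts H. f p)"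
    by (subst sum.swap) (simp add: sum.cartesian_product)
  finally show ?thesis .
qed

theorem theorem8:
  fixes G :: "'a pair_pre_digraph" and H :: "'b pair_pre_digraph"
  assumes "pair_graph G" and "pair_graph H"
    and "efficiently_dominated G"
  shows "roman_domination_number (cart_prod G H)
           \<ge> domination_number G * roman_domination_number H"
proof -
  interpret G: pair_graph G by fact
  interpret H: pair_graph H by fact
  obtain S where S: "S \<subseteq> pverts G" "card S = domination_number G"
    and disj: "\<And>u v. u \<in> S \<Longrightarrow> v \<in> S \<Longrightarrow> u \<noteq> v \<Longrightarrow> closed_nbhd G u \<inter> closed_nbhd G v = {}"
    using assms(3) unfolding efficiently_dominated_def dominating_set_def by blast
  obtain f where f: "roman_dominating (cart_prod G H) f"
    and weight: "(\<Sum>p \<in> pverts (cart_prod G H). f p) = roman_domination_number (cart_prod G H)"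
    using roman_domination_number_attained by blast
  let ?B = "\<lambda>u. closed_nbhd G u \<times> pverts H"
  have "domination_number G * roman_domination_number H = (\<Sum>u \<in> S. roman_domination_number H)"
    using S by simp
  also have "\<dots> \<le> (\<Sum>u \<in> S. \<Sum>p \<in> ?B u. f p)"
    using S by (intro sum_mono roman_domination_number_le_block assms(1) f) auto
  also have "\<dots> = (\<Sum>p \<in> (\<Union>u \<in> S. ?B u). f p)"
  proof (rule sum.UNION_disjoint[symmetric])
    show "finite S"
      using S G.pair_finite_verts by (blast intro: finite_subset)
    show "\<forall>u \<in> S. finite (?B u)"
      using G.finite_closed_nbhd H.pair_finite_verts by blast
    \<comment> \<open>Efficiency enters here: the first factors of two distinct blocks are disjoint,
      so no weight is counted twice.\<close>
    show "\<forall>u \<in> S. \<forall>v \<in> S. u \<noteq> v \<longrightarrow> ?B u \<inter> ?B v = {}"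
      using disj by blast
  qed
  \<comment> \<open>All blocks lie in the vertex set of the product, and \<open>f\<close> is
    nonnegative.\<close>
  also have "\<dots> \<le> (\<Sum>p \<in> pverts (cart_prod G H). f p)"
    using S G.closed_nbhd_subset
    by (intro sum_mono2) (auto simp: cart_prod_def G.pair_finite_verts H.pair_finite_verts)
  finally show ?thesis
    unfolding weight .
qed

end
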